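(* Let $\alpha$ be an ordinal. A substitution algebra of dimension $\alpha$ is representable if and only if it is embeddable in a substitution algebra of dimension $\alpha$ in which elements are strongly distinguished.
   Context: For a nonempty set $U$, $F_\alpha(U)$ is the set of all functions $U^\alpha\to U$. For $s\in U^\alpha$, $\kappa<\alpha$, $x\in U$, $s\langle\kappa,x\rangle$ agrees with $s$ except that its $\kappa$-th entry is $x$. On $F_\alpha(U)$ set $(f*_\kappa g)(s)=g(s\langle\kappa,f(s)\rangle)$ and $V_\kappa(s)=s_\kappa$. A function substitution algebra of dimension $\alpha$ ($FSA_\alpha$) is $\langle A,*_\kappa,V_\kappa\rangle_{\kappa<\alpha}$ with $A\subseteq F_\alpha(U)$ closed under every $*_\kappa$ and containing every $V_\kappa$. A substitution algebra of dimension $\alpha$ ($SA_\alpha$) is an algebra $\langle A,*_\kappa,v_\kappa\rangle_{\kappa<\alpha}$ satisfying, for all $\kappa,\lambda<\alpha$: (1) $x*_\kappa v_\kappa=x$; (2) $x*_\kappa v_\lambda=v_\lambda$ for $\kappa\neq\lambda$; (3) $v_\kappa*_\kappa x=x$; (4) if $w*_\lambda x=x$ for all $w$, then $x*_\lambda(v_\lambda*_\kappa z)=x*_\lambda(x*_\kappa z)$; (5) $(x*_\kappa y)*_\kappa z=x*_\kappa(y*_\kappa z)$; (6) if $w*_\lambda x=x$ for all $w$, then $x*_\kappa(y*_\lambda z)=(x*_\kappa y)*_\lambda(x*_\kappa z)$ for $\kappa\neq\lambda$. An $SA_\alpha$ is representable if it is isomorphic to an $FSA_\alpha$. For $x\in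 A$, $\Delta x=\{\kappa<\alpha: a*_\kappa x\neq x\text{ for some }a\in A\}$, $Z=\{x\in A:\Delta x=\emptyset\}$. For $s\in A^\alpha$, $a\in A$, finite $\Sigma=\{\kappa_0<\dots<\kappa_{n-1}\}\subseteq\alpha$: $s*_{(\Sigma)}a=s_{\kappa_{n-1}}*_{\kappa_{n-1}}(\cdots(s_{\kappa_0}*_{\kappa_0}a)\cdots)$, with $s*_{(\emptyset)}a=a$. Elements are strongly distinguished in the algebra if for all $a,b\in A$: whenever for every $s\in Z^\alpha$ there is a finite $\Sigma\subseteq\alpha$ with $s*_{(\Sigma)}a=s*_{(\Sigma)}b$, then $a=b$. *)

theory Defs
  imports Main "HOL-Library.FuncSet"
begin

text \<open>
  The dimension is an ordinal, rendered as a well-order relation r: the indices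
  below the ordinal are the elements of \<open>Field r\<close>. Unlike a type of class
  wellorder, this includes the ordinal 0 (\<open>r = {}\<close>).

  \<open>sbst A \<kappa> x y\<close> is \<open>x *\<^sub>\<kappa> y\<close>; it and \<open>vr A \<kappa>\<close> are meaningful only
  for \<open>\<kappa> \<in> Field r\<close> and arguments in \<open>elems A\<close>.
\<close>

record ('a, 'i) subst_struct =
  elems :: "'a set"
  sbst :: "'i \<Rightarrow> 'a \<Rightarrow> 'a \<Rightarrow> 'a"
  vr :: "'i \<Rightarrow> 'a"

definition SA :: "'i rel \<Rightarrow> ('a, 'i) subst_struct \<Rightarrow> bool" where
  "SA r A \<longleftrightarrow>
     (\<forall>\<kappa>\<in>Field r. vr A \<kappa> \<in> elems A) \<and>
     (\<forall>\<kappa>\<in>Field r. \<forall>x\<in>elems A. \<forall>y\<in>elems A. sbst A \<kappa> x y \<in> elems A) \<and>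
     (\<forall>\<kappa>\<in>Field r. \<forall>x\<in>elems A. sbst A \<kappa> x (vr A \<kappa>) = x) \<and>
     (\<forall>\<kappa>\<in>Field r. \<forall>\<mu>\<in>Field r. \<forall>x\<in>elems A. \<kappa> \<noteq> \<mu> \<longrightarrow> sbst A \<kappa> x (vr A \<mu>) = vr A \<mu>) \<and>
     (\<forall>\<kappa>\<in>Field r. \<forall>x\<in>elems A. sbst A \<kappa> (vr A \<kappa>) x = x) \<and>
     (\<forall>\<kappa>\<in>Field r. \<forall>\<mu>\<in>Field r. \<forall>x\<in>elems A. \<forall>z\<in>elems A.
        (\<forall>w\<in>elems A. sbst A \<mu> w x = x) \<longrightarrow>
        sbst A \<mu> x (sbst A \<kappa> (vr A \<mu>) z) = sbst A \<mu> x (sbst A \<kappa> x z)) \<and>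
     (\<forall>\<kappa>\<in>Field r. \<forall>x\<in>elems A. \<forall>y\<in>elems A. \<forall>z\<in>elems A.
        sbst A \<kappa> (sbst A \<kappa> x y) z = sbst A \<kappa> x (sbst A \<kappa> y z)) \<and>
     (\<forall>\<kappa>\<in>Field r. \<forall>\<mu>\<in>Field r. \<forall>x\<in>elems A. \<forall>y\<in>elems A. \<forall>z\<in>elems A.
        (\<forall>w\<in>elems A. sbst A \<mu> w x = x) \<longrightarrow> \<kappa> \<noteq> \<mu> \<longrightarrow>
        sbst A \<kappa> x (sbst A \<mu> y z) = sbst A \<mu> (sbst A \<kappa> x y) (sbst A \<kappa> x z))"

definition is_hom ::
  "'i rel \<Rightarrow> ('a, 'i) subst_struct \<Rightarrow> ('b, 'i) subst_struct \<Rightarrow> ('a \<Rightarrow> 'b) \<Rightarrow> bool" where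
  "is_hom r A B h \<longleftrightarrow>
     h \<in> elems A \<rightarrow> elems B \<and>
     (\<forall>\<kappa>\<in>Field r. h (vr A \<kappa>) = vr B \<kappa>) \<and>
     (\<forall>\<kappa>\<in>Field r. \<forall>x\<in>elems A. \<forall>y\<in>elems A. h (sbst A \<kappa> x y) = sbst B \<kappa> (h x) (h y))"

definition isomorphic ::
  "'i rel \<Rightarrow> ('a, 'i) subst_struct \<Rightarrow> ('b, 'i) subst_struct \<Rightarrow> bool" where
  "isomorphic r A B \<longleftrightarrow> (\<exists>h. is_hom r A B h \<and> bij_betw h (elems A) (elems B))"

definition embeddable ::
  "'i rel \<Rightarrow> ('a, 'i) subst_struct \<Rightarrow> ('b, 'i) subst_struct \<Rightarrow> bool" where
  "embeddable r A B \<longleftrightarrow> (\<exists>h. is_hom r A B h \<and> inj_on h (elems A))"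

text \<open>Sequences and functions are extensional, so that \<open>seqs r U\<close> and \<open>funs r U\<close> are
  exactly the sets of sequences over U and of functions from those sequences to U.\<close>

definition seqs :: "'i rel \<Rightarrow> 'u set \<Rightarrow> ('i \<Rightarrow> 'u) set" where
  "seqs r U = (Field r \<rightarrow>\<^sub>E U)"

definition funs :: "'i rel \<Rightarrow> 'u set \<Rightarrow> (('i \<Rightarrow> 'u) \<Rightarrow> 'u) set" where
  "funs r U = (seqs r U \<rightarrow>\<^sub>E U)"

definition fun_struct ::
  "'i rel \<Rightarrow> 'u set \<Rightarrow> (('i \<Rightarrow> 'u) \<Rightarrow> 'u) set \<Rightarrow> (('i \<Rightarrow> 'u) \<Rightarrow> 'u, 'i) subst_struct" where
  "fun_struct r U F =
     \<lparr>elems = F,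
      sbst = (\<lambda>\<kappa> f g. \<lambda>s\<in>seqs r U. g (s(\<kappa> := f s))),
      vr = (\<lambda>\<kappa>. \<lambda>s\<in>seqs r U. s \<kappa>)\<rparr>"

definition FSA :: "'i rel \<Rightarrow> 'u set \<Rightarrow> (('i \<Rightarrow> 'u) \<Rightarrow> 'u, 'i) subst_struct \<Rightarrow> bool" where
  "FSA r U A \<longleftrightarrow> U \<noteq> {} \<and> (\<exists>F \<subseteq> funs r U. A = fun_struct r U F \<and>
     (\<forall>\<kappa>\<in>Field r. vr A \<kappa> \<in> F) \<and>
     (\<forall>\<kappa>\<in>Field r. \<forall>f\<in>F. \<forall>g\<in>F. sbst A \<kappa> f g \<in> F))"

definition dimset :: "'i rel \<Rightarrow> ('a, 'i) subst_struct \<Rightarrow> 'a \<Rightarrow> 'i set" where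
  "dimset r A x = {\<kappa> \<in> Field r. \<exists>a\<in>elems A. sbst A \<kappa> a x \<noteq> x}"

definition zerodim :: "'i rel \<Rightarrow> ('a, 'i) subst_struct \<Rightarrow> 'a set" where
  "zerodim r A = {x \<in> elems A. dimset r A x = {}}"

definition increasing :: "'i rel \<Rightarrow> 'i list \<Rightarrow> bool" where
  "increasing r = sorted_wrt (\<lambda>\<kappa> \<mu>. (\<kappa>, \<mu>) \<in> r \<and> \<kappa> \<noteq> \<mu>)"

definition enum :: "'i rel \<Rightarrow> 'i set \<Rightarrow> 'i list" where
  "enum r \<Sigma> = (THE \<kappa>s. increasing r \<kappa>s \<and> set \<kappa>s = \<Sigma>)"

text \<open>\<open>fold\<close> processes the list from its head, so the substitution at the least
  index of \<open>\<Sigma>\<close> is innermost.\<close>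

definition multi_sbst ::
  "'i rel \<Rightarrow> ('a, 'i) subst_struct \<Rightarrow> ('i \<Rightarrow> 'a) \<Rightarrow> 'i set \<Rightarrow> 'a \<Rightarrow> 'a" where
  "multi_sbst r A s \<Sigma> a = fold (\<lambda>\<kappa> x. sbst A \<kappa> (s \<kappa>) x) (enum r \<Sigma>) a"

definition strongly_distinguished :: "'i rel \<Rightarrow> ('a, 'i) subst_struct \<Rightarrow> bool" where
  "strongly_distinguished r A \<longleftrightarrow>
     (\<forall>a\<in>elems A. \<forall>b\<in>elems A.
        (\<forall>s\<in>seqs r (zerodim r A). \<exists>\<Sigma>. finite \<Sigma> \<and> \<Sigma> \<subseteq> Field r \<and>
            multi_sbst r A s \<Sigma> a = multi_sbst r A s \<Sigma> b) \<longrightarrow>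
        a = b)"

text \<open>
  Representability, and embeddability into an algebra with strongly distinguished
  elements, quantify existentially over base sets and algebras of arbitrary size, while
  HOL cannot quantify over types. The type below, freely generated by the elements and
  the indices under pairing and index-indexed families, is large enough to serve as the
  universe for these quantifiers: lemmas \<open>representableI\<close> and \<open>sd_embeddableI\<close> show
  that a base set or an algebra found in any type whatsoever can be replaced by one in
  this type.
\<close>

datatype ('a, 'i) univ =
  Atom 'a | Index 'i | Node "('a, 'i) univ" "('a, 'i) univ" | Family "'i \<Rightarrow> ('a, 'i) univ"

definition representable :: "'i rel \<Rightarrow> ('a, 'i) subst_struct \<Rightarrow> bool" where
  "representable r A \<longleftrightarrow>
     (\<exists>(U :: ('a, 'i) univ set) B. FSA r U B \<and> isomorphic r A B)"


lemma enum_ex1: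
  assumes r: "Well_order r" and fin: "finite \<Sigma>" and sub: "\<Sigma> \<subseteq> Field r"
  shows "\<exists>!\<kappa>s. increasing r \<kappa>s \<and> set \<kappa>s = \<Sigma>"
proof -
  have tr: "trans r" and an: "antisym r" and tot: "total_on (Field r) r"
    using r by (auto simp: well_order_on_def linear_order_on_def partial_order_on_def preorder_on_def)
  define P where "P = (\<lambda>\<kappa> \<mu>. (\<kappa>, \<mu>) \<in> r \<and> \<kappa> \<noteq> \<mu>)"
  have Ptr: "P x y \<Longrightarrow> P y z \<Longrightarrow> P x z" for x y z
    using tr an unfolding P_def trans_def antisym_def by blast
  have Pas: "P x y \<Longrightarrow> \<not> P y x" for x y
    using an unfolding P_def antisym_def by blast
  have Ptot: "x \<in> Field r \<Longrightarrow> y \<in> Field r \<Longrightarrow> x \<noteq> y \<Longrightarrow> P x y \<or> P y x" for x y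
    using tot unfolding P_def total_on_def by blast
  have ex: "\<exists>\<kappa>s. sorted_wrt P \<kappa>s \<and> set \<kappa>s = \<Sigma>"
    using fin sub
  proof (induction \<Sigma>)
    case empty
    show ?case by (intro exI[of _ "[]"]) simp
  next
    case (insert x S)
    then obtain xs where xs: "sorted_wrt P xs" "set xs = S" by auto
    let ?ys = "filter (\<lambda>y. P y x) xs @ x # filter (\<lambda>y. P x y) xs"
    have "sorted_wrt P ?ys"
      using xs by (auto simp: sorted_wrt_append sorted_wrt_filter intro: Ptr)
    moreover have "set ?ys = insert x S"
      using insert.hyps insert.prems xs Ptot by auto
    ultimately show ?case by blast
  qed
  have un: "xs = ys" if "sorted_wrt P xs" "sorted_wrt P ys" "set xs = set ys" for xs ys
    using that
  proof (induction xs arbitrary: ys)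
    case Nil
    then show ?case by simp
  next
    case (Cons x xs)
    then obtain y ys' where ys: "ys = y # ys'" by (cases ys) auto
    have xy: "x = y"
    proof (rule ccontr)
      assume "x \<noteq> y"
      then have "x \<in> set ys'" "y \<in> set xs" using Cons.prems(3) ys by auto
      then show False using Cons.prems(1,2) ys Pas by auto
    qed
    have "x \<notin> set xs" "y \<notin> set ys'" using Cons.prems(1,2) ys Pas by auto
    then have "set xs = set ys'" using Cons.prems(3) ys xy by auto
    then show ?case using Cons ys xy by auto
  qed
  show ?thesis
    unfolding increasing_def P_def[symmetric] using ex un by blast
qed

lemma set_enum:
  assumes "Well_order r" "finite \<Sigma>" "\<Sigma> \<subseteq> Field r"
  shows "increasing r (enum r \<Sigma>)" "set (enum r \<Sigma>) = \<Sigma>"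
  using theI'[OF enum_ex1[OF assms]] unfolding enum_def by auto

primrec univ_eval ::
  "('a \<Rightarrow> ('i \<Rightarrow> 'u) \<Rightarrow> 'u) \<Rightarrow> ('a \<Rightarrow> 'a \<Rightarrow> 'i \<Rightarrow> 'u) \<Rightarrow> 'u \<Rightarrow> 'i set \<Rightarrow> ('a, 'i) univ \<Rightarrow> 'u \<times> ('i \<Rightarrow> 'u)" where
  "univ_eval app w u I (Atom a) = (u, undefined)"
| "univ_eval app w u I (Index i) = (u, undefined)"
| "univ_eval app w u I (Family t) = (u, \<lambda>i\<in>I. fst (univ_eval app w u I (t i)))"
| "univ_eval app w u I (Node p q) =
     (case p of Atom a \<Rightarrow> (app a (snd (univ_eval app w u I q)), undefined)
      | Node a b \<Rightarrow> (case a of Atom a' \<Rightarrow> (case b of Atom b' \<Rightarrow> (case q of Index i \<Rightarrow> (w a' b' i, undefined)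
          | _ \<Rightarrow> (u, undefined)) | _ \<Rightarrow> (u, undefined)) | _ \<Rightarrow> (u, undefined))
      | _ \<Rightarrow> (u, undefined))"

inductive_set base_hull ::
  "('a \<Rightarrow> ('i \<Rightarrow> 'u) \<Rightarrow> 'u) \<Rightarrow> ('a \<Rightarrow> 'a \<Rightarrow> 'i \<Rightarrow> 'u) \<Rightarrow> 'u \<Rightarrow> 'i set \<Rightarrow> 'a set \<Rightarrow> 'u set"
  for app w u I E where
  start: "u \<in> base_hull app w u I E"
| wit: "a \<in> E \<Longrightarrow> b \<in> E \<Longrightarrow> a \<noteq> b \<Longrightarrow> i \<in> I \<Longrightarrow> w a b i \<in> base_hull app w u I E"
| app: "a \<in> E \<Longrightarrow> (\<And>i. i \<in> I \<Longrightarrow> t i \<in> base_hull app w u I E) \<Longrightarrow> t \<in> extensional I \<Longrightarrow>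
    app a t \<in> base_hull app w u I E"

lemma base_hull_range: "x \<in> base_hull app w u I E \<Longrightarrow> \<exists>c. x = fst (univ_eval app w u I c)"
proof (induction rule: base_hull.induct)
  case start
  show ?case by (rule exI[of _ "Index undefined"]) simp
next
  case (wit a b i)
  show ?case by (rule exI[of _ "Node (Node (Atom a) (Atom b)) (Index i)"]) simp
next
  case (app a t)
  then obtain c where c: "\<And>i. i \<in> I \<Longrightarrow> t i = fst (univ_eval app w u I (c i))" by metis
  have "t = (\<lambda>i\<in>I. fst (univ_eval app w u I (c i)))"
    using app.hyps(3) c by (auto simp: fun_eq_iff extensional_def)
  then show ?case by (intro exI[of _ "Node (Atom a) (Family c)"]) simp
qed

lemma representableI:
  fixes A :: "('a, 'i) subst_struct" and U :: "'u set"
  assumes A: "SA r A" and B: "FSA r U B" and iso: "isomorphic r A B"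
  shows "representable r A"
proof -
  let ?I = "Field r" and ?E = "elems A"
  obtain F where U: "U \<noteq> {}" and F: "F \<subseteq> funs r U" and BF: "B = fun_struct r U F"
    using B unfolding FSA_def by auto
  obtain \<phi> where hom: "is_hom r A B \<phi>" and bij: "bij_betw \<phi> ?E F"
    using iso unfolding isomorphic_def BF fun_struct_def by auto
  have \<phi>F: "\<phi> a \<in> funs r U" if "a \<in> ?E" for a
    using that bij F by (auto simp: bij_betw_def)
  have vA: "vr A \<kappa> \<in> ?E" if "\<kappa> \<in> ?I" for \<kappa> using that A by (auto simp: SA_def)
  have sA: "sbst A \<kappa> x y \<in> ?E" if "\<kappa> \<in> ?I" "x \<in> ?E" "y \<in> ?E" for \<kappa> x y
    using that A by (auto simp: SA_def)
  have \<phi>v: "\<phi> (vr A \<kappa>) s = s \<kappa>" if "\<kappa> \<in> ?I" "s \<in> seqs r U" for \<kappa> s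
    using that hom by (auto simp: is_hom_def BF fun_struct_def)
  have \<phi>s: "\<phi> (sbst A \<kappa> x y) s = \<phi> y (s(\<kappa> := \<phi> x s))"
    if "\<kappa> \<in> ?I" "x \<in> ?E" "y \<in> ?E" "s \<in> seqs r U" for \<kappa> x y s
    using that hom by (auto simp: is_hom_def BF fun_struct_def)
  obtain u where u: "u \<in> U" using U by blast
  have "\<exists>s. a \<in> ?E \<longrightarrow> b \<in> ?E \<longrightarrow> a \<noteq> b \<longrightarrow> s \<in> seqs r U \<and> \<phi> a s \<noteq> \<phi> b s" for a b
  proof (cases "a \<in> ?E \<and> b \<in> ?E \<and> a \<noteq> b")
    case True
    then have "\<phi> a \<noteq> \<phi> b" using bij by (auto simp: bij_betw_def inj_on_def)
    then show ?thesis
      using \<phi>F[of a] \<phi>F[of b] True unfolding funs_def by (meson PiE_ext)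
  qed auto
  then obtain w where w: "\<And>a b. a \<in> ?E \<Longrightarrow> b \<in> ?E \<Longrightarrow> a \<noteq> b \<Longrightarrow>
      w a b \<in> seqs r U \<and> \<phi> a (w a b) \<noteq> \<phi> b (w a b)"
    by metis
  define C where "C = base_hull \<phi> w u ?I ?E"
  have CU: "C \<subseteq> U"
  proof
    fix x assume "x \<in> C"
    then show "x \<in> U" unfolding C_def
    proof (induction rule: base_hull.induct)
      case start
      show ?case by (rule u)
    next
      case (wit a b i)
      then show ?case using w[of a b] by (auto simp: seqs_def)
    next
      case (app a t)
      then have "t \<in> seqs r U" by (auto simp: seqs_def PiE_def)
      then show ?case using \<phi>F[OF app.hyps(1)] by (auto simp: funs_def)
    qed
  qed
  have C\<phi>: "\<phi> a t \<in> C" if "a \<in> ?E" "t \<in> seqs r C" for a t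
    using that unfolding C_def by (auto simp: seqs_def PiE_def intro!: base_hull.app)
  have sCU: "t \<in> seqs r U" if "t \<in> seqs r C" for t
    using that CU by (auto simp: seqs_def PiE_def Pi_def)
  define ev where "ev = (\<lambda>c. fst (univ_eval \<phi> w u ?I c))"
  define g where "g = inv_into UNIV ev"
  define k where "k = inv_into C g"
  have "C \<subseteq> range ev" unfolding C_def ev_def using base_hull_range by fast
  then have inj: "inj_on g C" unfolding g_def by (intro inj_on_inv_into)
  have kg: "k (g x) = x" if "x \<in> C" for x using that inj by (simp add: k_def)
  have gk: "g (k x) = x" "k x \<in> C" if "x \<in> g ` C" for x
    using that by (auto simp: kg)
  define U' where "U' = g ` C"
  define pull where "pull = (\<lambda>t. \<lambda>i\<in>?I. k (t i))"
  have pull: "pull t \<in> seqs r C" if "t \<in> seqs r U'" for t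
    using that gk by (auto simp: pull_def seqs_def U'_def)
  define \<psi> where "\<psi> = (\<lambda>a. \<lambda>t\<in>seqs r U'. g (\<phi> a (pull t)))"
  have \<psi>F: "\<psi> a \<in> funs r U'" if "a \<in> ?E" for a
    using that by (auto simp: \<psi>_def funs_def U'_def[symmetric] intro!: C\<phi> pull)
       (auto simp: U'_def intro!: C\<phi> pull[unfolded U'_def])
  define B' where "B' = fun_struct r U' (\<psi> ` ?E)"
  have vB: "\<psi> (vr A \<kappa>) = vr B' \<kappa>" if k: "\<kappa> \<in> ?I" for \<kappa>
  proof (rule ext)
    fix t
    show "\<psi> (vr A \<kappa>) t = vr B' \<kappa> t"
    proof (cases "t \<in> seqs r U'")
      case True
      then have "\<phi> (vr A \<kappa>) (pull t) = k (t \<kappa>)"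
        using k by (simp add: \<phi>v sCU pull) (simp add: pull_def)
      moreover have "t \<kappa> \<in> g ` C" using True k by (auto simp: seqs_def U'_def)
      ultimately show ?thesis
        using True by (simp add: \<psi>_def B'_def fun_struct_def gk)
    qed (simp add: \<psi>_def B'_def fun_struct_def)
  qed
  have sB: "\<psi> (sbst A \<kappa> x y) = sbst B' \<kappa> (\<psi> x) (\<psi> y)"
    if k: "\<kappa> \<in> ?I" and x: "x \<in> ?E" and y: "y \<in> ?E" for \<kappa> x y
  proof (rule ext)
    fix t
    show "\<psi> (sbst A \<kappa> x y) t = sbst B' \<kappa> (\<psi> x) (\<psi> y) t"
    proof (cases "t \<in> seqs r U'")
      case True
      let ?v = "\<phi> x (pull t)"
      have v: "?v \<in> C" using True x by (intro C\<phi> pull)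
      have t': "t(\<kappa> := g ?v) \<in> seqs r U'"
        using True v k by (auto simp: seqs_def U'_def PiE_def extensional_def Pi_def)
      have "pull (t(\<kappa> := g ?v)) = (pull t)(\<kappa> := ?v)"
        using v k by (auto simp: pull_def fun_eq_iff kg)
      then show ?thesis
        using True t' k x y by (simp add: \<psi>_def B'_def fun_struct_def \<phi>s sCU pull)
    qed (simp add: \<psi>_def B'_def fun_struct_def)
  qed
  have inj\<psi>: "inj_on \<psi> ?E"
  proof (rule inj_onI, rule ccontr)
    fix a b assume ab: "a \<in> ?E" "b \<in> ?E" "\<psi> a = \<psi> b" "a \<noteq> b"
    have s: "w a b \<in> seqs r C"
      using w[OF ab(1,2,4)] ab unfolding C_def
      by (auto simp: seqs_def PiE_def intro!: base_hull.wit)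
    define t where "t = (\<lambda>i\<in>?I. g (w a b i))"
    have t: "t \<in> seqs r U'" using s by (auto simp: t_def seqs_def U'_def)
    have "pull t = w a b"
      using s by (auto simp: pull_def t_def fun_eq_iff seqs_def PiE_def extensional_def Pi_def kg)
    then have "g (\<phi> a (w a b)) = g (\<phi> b (w a b))"
      using t fun_cong[OF ab(3), of t] by (simp add: \<psi>_def)
    then have "\<phi> a (w a b) = \<phi> b (w a b)"
      using inj s ab by (meson C\<phi> inj_onD)
    then show False using w[OF ab(1,2,4)] by simp
  qed
  have "U' \<noteq> {}" unfolding U'_def C_def using base_hull.start by fast
  moreover have "\<psi> ` ?E \<subseteq> funs r U'" using \<psi>F by blast
  moreover have "vr B' \<kappa> \<in> \<psi> ` ?E" if "\<kappa> \<in> ?I" for \<kappa>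
    using vB[OF that] vA[OF that] by (metis imageI)
  moreover have "sbst B' \<kappa> f g \<in> \<psi> ` ?E"
    if "\<kappa> \<in> ?I" "f \<in> \<psi> ` ?E" "g \<in> \<psi> ` ?E" for \<kappa> f g
    using that sB[OF that(1)] sA[OF that(1)] by (auto simp flip: sB)
  ultimately have "FSA r U' B'"
    unfolding FSA_def using B'_def by (intro conjI exI[of _ "\<psi> ` ?E"]) auto
  moreover have "isomorphic r A B'"
    unfolding isomorphic_def is_hom_def using inj\<psi> vB sB
    by (intro exI[of _ \<psi>]) (auto simp: bij_betw_def B'_def fun_struct_def)
  ultimately show ?thesis unfolding representable_def by blast
qed


lemma fold_sbst_hom:
  assumes "SA r A" "is_hom r A B h" "set \<kappa>s \<subseteq> Field r" "a \<in> elems A"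
    and "\<And>\<kappa>. \<kappa> \<in> Field r \<Longrightarrow> s \<kappa> \<in> elems A \<and> s' \<kappa> = h (s \<kappa>)"
  shows "fold (\<lambda>\<kappa> x. sbst B \<kappa> (s' \<kappa>) x) \<kappa>s (h a) = h (fold (\<lambda>\<kappa> x. sbst A \<kappa> (s \<kappa>) x) \<kappa>s a) \<and>
    fold (\<lambda>\<kappa> x. sbst A \<kappa> (s \<kappa>) x) \<kappa>s a \<in> elems A"
  using assms(3,4)
proof (induction \<kappa>s arbitrary: a)
  case (Cons \<kappa> \<kappa>s)
  have "sbst A \<kappa> (s \<kappa>) a \<in> elems A"
    using Cons.prems assms(1,5) by (auto simp: SA_def)
  moreover have "sbst B \<kappa> (s' \<kappa>) (h a) = h (sbst A \<kappa> (s \<kappa>) a)"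
    using Cons.prems assms(2,5) by (auto simp: is_hom_def)
  ultimately show ?case using Cons by simp
qed simp

lemma SA_transport:
  assumes A: "SA r A" and hom: "is_hom r A B h" and bij: "bij_betw h (elems A) (elems B)"
  shows "SA r B"
proof -
  have E: "elems B = h ` elems A" using bij by (simp add: bij_betw_def)
  have inj: "h x = h y \<longleftrightarrow> x = y" if "x \<in> elems A" "y \<in> elems A" for x y
    using bij that by (auto simp: bij_betw_def inj_on_def)
  have v: "vr B \<kappa> = h (vr A \<kappa>)" "vr A \<kappa> \<in> elems A" if "\<kappa> \<in> Field r" for \<kappa>
    using hom A that by (auto simp: is_hom_def SA_def)
  have s: "sbst B \<kappa> (h x) (h y) = h (sbst A \<kappa> x y)" "sbst A \<kappa> x y \<in> elems A"
    if "\<kappa> \<in> Field r" "x \<in> elems A" "y \<in> elems A" for \<kappa> x y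
    using hom A that by (auto simp: is_hom_def SA_def)
  show ?thesis
    using A unfolding SA_def E ball_simps
    by (simp add: v s inj)
qed

lemma strongly_distinguished_transport:
  assumes r: "Well_order r" and A: "SA r A" and hom: "is_hom r A B h"
    and bij: "bij_betw h (elems A) (elems B)" and sd: "strongly_distinguished r A"
  shows "strongly_distinguished r B"
proof -
  have E: "elems B = h ` elems A" using bij by (simp add: bij_betw_def)
  have inj: "h x = h y \<longleftrightarrow> x = y" if "x \<in> elems A" "y \<in> elems A" for x y
    using bij that by (auto simp: bij_betw_def inj_on_def)
  have s: "sbst B \<kappa> (h x) (h y) = h (sbst A \<kappa> x y)" "sbst A \<kappa> x y \<in> elems A"
    if "\<kappa> \<in> Field r" "x \<in> elems A" "y \<in> elems A" for \<kappa> x y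
    using hom A that by (auto simp: is_hom_def SA_def)
  have D: "dimset r B (h x) = dimset r A x" if "x \<in> elems A" for x
    using that by (auto simp: dimset_def E s inj)
  have Z: "h x \<in> zerodim r B" if "x \<in> zerodim r A" for x
    using that by (auto simp: zerodim_def D E)
  show ?thesis
    unfolding strongly_distinguished_def E ball_simps
  proof (intro ballI impI)
    fix a b assume a: "a \<in> elems A" and b: "b \<in> elems A"
      and H: "\<forall>s\<in>seqs r (zerodim r B). \<exists>\<Sigma>. finite \<Sigma> \<and> \<Sigma> \<subseteq> Field r \<and>
            multi_sbst r B s \<Sigma> (h a) = multi_sbst r B s \<Sigma> (h b)"
    have "\<exists>\<Sigma>. finite \<Sigma> \<and> \<Sigma> \<subseteq> Field r \<and> multi_sbst r A s \<Sigma> a = multi_sbst r A s \<Sigma> b"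
      if sZ: "s \<in> seqs r (zerodim r A)" for s
    proof -
      define s' where "s' = (\<lambda>\<kappa>\<in>Field r. h (s \<kappa>))"
      have "s' \<in> seqs r (zerodim r B)" using sZ Z by (auto simp: s'_def seqs_def)
      then obtain \<Sigma> where \<Sigma>: "finite \<Sigma>" "\<Sigma> \<subseteq> Field r"
        "multi_sbst r B s' \<Sigma> (h a) = multi_sbst r B s' \<Sigma> (h b)"
        using H by blast
      have *: "s \<kappa> \<in> elems A \<and> s' \<kappa> = h (s \<kappa>)" if "\<kappa> \<in> Field r" for \<kappa>
        using that sZ by (auto simp: s'_def seqs_def zerodim_def)
      have **: "set (enum r \<Sigma>) \<subseteq> Field r" using set_enum(2)[OF r \<Sigma>(1,2)] \<Sigma>(2) by simp
      show ?thesis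
        using \<Sigma> fold_sbst_hom[OF A hom ** a *] fold_sbst_hom[OF A hom ** b *]
        by (intro exI[of _ \<Sigma>]) (simp add: multi_sbst_def inj)
    qed
    then show "h a = h b"
      using sd a b unfolding strongly_distinguished_def by blast
  qed
qed

fun sd_eval ::
  "('a \<Rightarrow> 'b) \<Rightarrow> ('i \<Rightarrow> 'b) \<Rightarrow> ('i \<Rightarrow> 'b \<Rightarrow> 'b \<Rightarrow> 'b) \<Rightarrow> ('i \<Rightarrow> 'b \<Rightarrow> 'b \<Rightarrow> 'b) \<Rightarrow> ('i \<Rightarrow> 'b \<Rightarrow> 'b) \<Rightarrow>
    ('a, 'i) univ \<Rightarrow> 'b" where
  "sd_eval h v sb w d (Atom a) = h a"
| "sd_eval h v sb w d (Index i) = v i"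
| "sd_eval h v sb w d (Node (Index i) (Node x y)) =
     sb i (sd_eval h v sb w d x) (sd_eval h v sb w d y)"
| "sd_eval h v sb w d (Node (Node (Index i) x) y) =
     w i (sd_eval h v sb w d x) (sd_eval h v sb w d y)"
| "sd_eval h v sb w d (Node (Node (Node x y) (Index i)) z) = d i (sd_eval h v sb w d z)"
| "sd_eval h v sb w d _ = undefined"

inductive_set sd_hull ::
  "('a \<Rightarrow> 'b) \<Rightarrow> ('i \<Rightarrow> 'b) \<Rightarrow> ('i \<Rightarrow> 'b \<Rightarrow> 'b \<Rightarrow> 'b) \<Rightarrow> ('i \<Rightarrow> 'b \<Rightarrow> 'b \<Rightarrow> 'b) \<Rightarrow> ('i \<Rightarrow> 'b \<Rightarrow> 'b) \<Rightarrow>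
    'i set \<Rightarrow> 'a set \<Rightarrow> ('i \<Rightarrow> 'b set) \<Rightarrow> 'b set"
  for h v sb w d I E D where
  gen: "a \<in> E \<Longrightarrow> h a \<in> sd_hull h v sb w d I E D"
| var: "i \<in> I \<Longrightarrow> v i \<in> sd_hull h v sb w d I E D"
| sbst: "i \<in> I \<Longrightarrow> x \<in> sd_hull h v sb w d I E D \<Longrightarrow> y \<in> sd_hull h v sb w d I E D \<Longrightarrow>
    sb i x y \<in> sd_hull h v sb w d I E D"
| wit: "i \<in> I \<Longrightarrow> x \<in> sd_hull h v sb w d I E D \<Longrightarrow> y \<in> sd_hull h v sb w d I E D \<Longrightarrow> x \<noteq> y \<Longrightarrow>
    w i x y \<in> sd_hull h v sb w d I E D"
| dep: "i \<in> I \<Longrightarrow> x \<in> sd_hull h v sb w d I E D \<Longrightarrow> x \<in> D i \<Longrightarrow> d i x \<in> sd_hull h v sb w d I E D"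

lemma sd_hull_range: "x \<in> sd_hull h v sb w d I E D \<Longrightarrow> \<exists>c. x = sd_eval h v sb w d c"
proof (induction rule: sd_hull.induct)
  case (gen a)
  show ?case by (rule exI[of _ "Atom a"]) simp
next
  case (var i)
  show ?case by (rule exI[of _ "Index i"]) simp
next
  case (sbst i x y)
  then obtain c e where "x = sd_eval h v sb w d c" "y = sd_eval h v sb w d e" by blast
  then show ?case by (intro exI[of _ "Node (Index i) (Node c e)"]) simp
next
  case (wit i x y)
  then obtain c e where "x = sd_eval h v sb w d c" "y = sd_eval h v sb w d e" by blast
  then show ?case by (intro exI[of _ "Node (Node (Index i) c) e"]) simp
next
  case (dep i x)
  then obtain c where "x = sd_eval h v sb w d c" by blast
  then show ?case
    by (intro exI[of _ "Node (Node (Node (Index i) (Index i)) (Index i)) c"]) simp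
qed

lemma sd_embeddableI:
  fixes A :: "('a, 'i) subst_struct" and B :: "('b, 'i) subst_struct"
  assumes r: "Well_order r" and B: "SA r B" and sd: "strongly_distinguished r B"
    and emb: "embeddable r A B"
  shows "\<exists>B' :: (('a, 'i) univ, 'i) subst_struct.
    SA r B' \<and> strongly_distinguished r B' \<and> embeddable r A B'"
proof -
  obtain h where hom: "is_hom r A B h" and injh: "inj_on h (elems A)"
    using emb unfolding embeddable_def by blast
  define Q where "Q = (\<lambda>s a b. s \<in> seqs r (zerodim r B) \<and>
      (\<forall>\<Sigma>. finite \<Sigma> \<longrightarrow> \<Sigma> \<subseteq> Field r \<longrightarrow> multi_sbst r B s \<Sigma> a \<noteq> multi_sbst r B s \<Sigma> b))"
  have ex: "\<exists>s. Q s a b" if "a \<in> elems B" "b \<in> elems B" "a \<noteq> b" for a b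
  proof (rule ccontr)
    assume "\<nexists>s. Q s a b"
    then have "\<forall>s\<in>seqs r (zerodim r B). \<exists>\<Sigma>. finite \<Sigma> \<and> \<Sigma> \<subseteq> Field r \<and>
        multi_sbst r B s \<Sigma> a = multi_sbst r B s \<Sigma> b"
      unfolding Q_def by blast
    then show False using sd that unfolding strongly_distinguished_def by metis
  qed
  define w where "w = (\<lambda>a b. SOME s. Q s a b)"
  have w: "\<And>a b. a \<in> elems B \<Longrightarrow> b \<in> elems B \<Longrightarrow> a \<noteq> b \<Longrightarrow> Q (w a b) a b"
    unfolding w_def using ex by (rule someI_ex)
  have "\<exists>a. \<kappa> \<in> dimset r B x \<longrightarrow> a \<in> elems B \<and> sbst B \<kappa> a x \<noteq> x" for \<kappa> x
    by (auto simp: dimset_def)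
  then obtain d where d: "\<And>\<kappa> x. \<kappa> \<in> dimset r B x \<Longrightarrow> d \<kappa> x \<in> elems B \<and> sbst B \<kappa> (d \<kappa> x) x \<noteq> x"
    by metis
  define C where "C = sd_hull h (vr B) (sbst B) (\<lambda>i a b. w a b i) d (Field r) (elems A)
      (\<lambda>\<kappa>. {x. \<kappa> \<in> dimset r B x})"
  have CB: "x \<in> elems B" if "x \<in> C" for x
    using that unfolding C_def
  proof (induction rule: sd_hull.induct)
    case (wit i x y)
    then show ?case using w[of x y] by (auto simp: Q_def seqs_def zerodim_def)
  qed (use hom B d in \<open>auto simp: is_hom_def SA_def\<close>)
  have Ch: "h a \<in> C" if "a \<in> elems A" for a using that unfolding C_def by (rule sd_hull.gen)
  have Cv: "vr B \<kappa> \<in> C" if "\<kappa> \<in> Field r" for \<kappa> using that unfolding C_def by (rule sd_hull.var)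
  have Cs: "sbst B \<kappa> x y \<in> C" if "\<kappa> \<in> Field r" "x \<in> C" "y \<in> C" for \<kappa> x y
    using that unfolding C_def by (rule sd_hull.sbst)
  have Cw: "w x y \<kappa> \<in> C" if "\<kappa> \<in> Field r" "x \<in> C" "y \<in> C" "x \<noteq> y" for \<kappa> x y
    using that unfolding C_def by (rule sd_hull.wit)
  have Cd: "d \<kappa> x \<in> C" if "\<kappa> \<in> dimset r B x" "x \<in> C" for \<kappa> x
    using that unfolding C_def by (auto simp: dimset_def intro!: sd_hull.dep)
  define S where "S = \<lparr>elems = C, sbst = sbst B, vr = vr B\<rparr>"
  have indep: "(\<forall>a\<in>C. sbst B \<kappa> a x = x) \<longleftrightarrow> (\<forall>a\<in>elems B. sbst B \<kappa> a x = x)"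
    if "\<kappa> \<in> Field r" "x \<in> C" for \<kappa> x
    using that CB d[of \<kappa> x] Cd[of \<kappa> x] by (auto simp: dimset_def)
  have SAS: "SA r S"
    using B unfolding SA_def S_def by (simp add: indep CB Cv Cs)
  have ZS: "zerodim r S = zerodim r B \<inter> C"
    using indep CB by (auto simp: zerodim_def dimset_def S_def)
  have sdS: "strongly_distinguished r S"
    unfolding strongly_distinguished_def
  proof (intro ballI impI, rule ccontr)
    fix a b assume a: "a \<in> elems S" and b: "b \<in> elems S" and ne: "a \<noteq> b"
      and H: "\<forall>s\<in>seqs r (zerodim r S). \<exists>\<Sigma>. finite \<Sigma> \<and> \<Sigma> \<subseteq> Field r \<and>
            multi_sbst r S s \<Sigma> a = multi_sbst r S s \<Sigma> b"
    have ab: "a \<in> C" "b \<in> C" using a b by (auto simp: S_def)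
    have W: "Q (w a b) a b" using w ab CB ne by blast
    then have "w a b \<in> seqs r (zerodim r S)"
      using Cw[OF _ ab ne] unfolding ZS Q_def seqs_def by (auto simp: PiE_def)
    then obtain \<Sigma> where "finite \<Sigma>" "\<Sigma> \<subseteq> Field r"
      "multi_sbst r S (w a b) \<Sigma> a = multi_sbst r S (w a b) \<Sigma> b"
      using H by blast
    then show False using W by (auto simp: Q_def multi_sbst_def S_def)
  qed
  define ev where "ev = sd_eval h (vr B) (sbst B) (\<lambda>i a b. w a b i) d"
  define g where "g = inv_into UNIV ev"
  define k where "k = inv_into C g"
  have "C \<subseteq> range ev" unfolding C_def ev_def using sd_hull_range by fast
  then have inj: "inj_on g C" unfolding g_def by (intro inj_on_inv_into)
  have kg: "k (g x) = x" if "x \<in> C" for x using that inj by (simp add: k_def)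
  define B' where "B' = \<lparr>elems = g ` C, sbst = (\<lambda>\<kappa> x y. g (sbst B \<kappa> (k x) (k y))),
      vr = (\<lambda>\<kappa>. g (vr B \<kappa>))\<rparr>"
  have gh: "is_hom r S B' g" by (auto simp: is_hom_def S_def B'_def kg)
  have gb: "bij_betw g (elems S) (elems B')" using inj by (simp add: bij_betw_def S_def B'_def)
  have "is_hom r A B' (g \<circ> h)"
    using hom Ch by (auto simp: is_hom_def B'_def kg)
  moreover have "inj_on (g \<circ> h) (elems A)"
    using injh inj Ch by (auto intro!: comp_inj_on intro: inj_on_subset)
  ultimately have "embeddable r A B'" unfolding embeddable_def by blast
  then show ?thesis
    using SA_transport[OF SAS gh gb] strongly_distinguished_transport[OF r SAS gh gb sdS] by blast
qed

end

theory Submission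
  imports Defs
begin

text \<open>
  The algebra of all functions from \<open>U\<^sup>\<alpha>\<close> to \<open>U\<close> is strongly distinguished: if a and b differ at
  the sequence p, then substituting the constants \<open>p\<^sub>\<kappa>\<close> never makes them equal.

  Conversely, let B be strongly distinguished, and for finite \<open>\<Sigma>\<close> let \<open>D\<^sub>\<Sigma>\<close> be the set of
  elements of B independent of all indices in \<open>\<Sigma>\<close>. Substitutions of elements of \<open>D\<^sub>\<Sigma>\<close> at
  distinct indices of \<open>\<Sigma>\<close> commute, so they behave like a simultaneous substitution. The base set
  is the reduced product of the \<open>D\<^sub>\<Sigma>\<close> along the filter of finite subsets of \<open>\<alpha>\<close>, and an element g
  acts on a sequence p of base elements by \<open>g(p)(\<Sigma>) = p(\<Sigma>) *\<^sub>(\<^sub>\<Sigma>\<^sub>) g\<close>. Sequences of zero-dimensional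
  elements, viewed as constant families, witness that this action is faithful.
\<close>

section \<open>The algebra of all functions on sequences\<close>

abbreviation full_struct :: "'i rel \<Rightarrow> 'u set \<Rightarrow> (('i \<Rightarrow> 'u) \<Rightarrow> 'u, 'i) subst_struct" where
  "full_struct r U \<equiv> fun_struct r U (funs r U)"

lemma seqs_upd: "s \<in> seqs r U \<Longrightarrow> \<kappa> \<in> Field r \<Longrightarrow> x \<in> U \<Longrightarrow> s(\<kappa> := x) \<in> seqs r U"
  by (auto simp: seqs_def PiE_def extensional_def)

lemma funs_app: "f \<in> funs r U \<Longrightarrow> s \<in> seqs r U \<Longrightarrow> f s \<in> U"
  by (auto simp: funs_def)

lemma funs_eqI:
  "f \<in> funs r U \<Longrightarrow> g \<in> funs r U \<Longrightarrow> (\<And>s. s \<in> seqs r U \<Longrightarrow> f s = g s) \<Longrightarrow> f = g"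
  unfolding funs_def by (rule PiE_ext)

lemma elems_full [simp]: "elems (full_struct r U) = funs r U"
  by (simp add: fun_struct_def)

lemma sbst_full_app:
  "s \<in> seqs r U \<Longrightarrow> sbst (fun_struct r U F) \<kappa> f g s = g (s(\<kappa> := f s))"
  by (simp add: fun_struct_def)

lemma vr_full_app: "s \<in> seqs r U \<Longrightarrow> vr (fun_struct r U F) \<kappa> s = s \<kappa>"
  by (simp add: fun_struct_def)

lemma vr_full_in: "\<kappa> \<in> Field r \<Longrightarrow> vr (fun_struct r U F) \<kappa> \<in> funs r U"
  by (auto simp: fun_struct_def funs_def seqs_def)

lemma sbst_full_in:
  "\<kappa> \<in> Field r \<Longrightarrow> f \<in> funs r U \<Longrightarrow> g \<in> funs r U \<Longrightarrow> sbst (fun_struct r U F) \<kappa> f g \<in> funs r U"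
  by (auto simp: fun_struct_def funs_app seqs_upd funs_def PiE_mem)

lemma SA_full: "SA r (full_struct r U)"
proof -
  let ?A = "full_struct r U"
  note app = sbst_full_app vr_full_app funs_app seqs_upd
  \<comment> \<open>Independence of \<mu> is stated with elements \<open>w\<close> of the algebra;
    evaluated at \<open>s\<close>, it says that overwriting the coordinate \<mu> by
    \<open>w s\<close> does not change the value of \<open>x\<close>.\<close>
  have ind: "x (s(\<mu> := w s)) = x s"
    if "\<forall>w\<in>funs r U. sbst ?A \<mu> w x = x" "w \<in> funs r U" "s \<in> seqs r U" for x \<mu> w s
    using that by (metis sbst_full_app)
  have 4: "sbst ?A \<mu> x (sbst ?A \<kappa> (vr ?A \<mu>) z) = sbst ?A \<mu> x (sbst ?A \<kappa> x z)"
    if "\<kappa> \<in> Field r" "\<mu> \<in> Field r" "x \<in> funs r U" "z \<in> funs r U"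
      "\<forall>w\<in>funs r U. sbst ?A \<mu> w x = x" for \<kappa> \<mu> x z
    by (rule funs_eqI[of _ r U])
      (use that in \<open>simp_all add: sbst_full_in vr_full_in app ind\<close>)
  have 6: "sbst ?A \<kappa> x (sbst ?A \<mu> y z) = sbst ?A \<mu> (sbst ?A \<kappa> x y) (sbst ?A \<kappa> x z)"
    if "\<kappa> \<in> Field r" "\<mu> \<in> Field r" "x \<in> funs r U" "y \<in> funs r U" "z \<in> funs r U"
      "\<forall>w\<in>funs r U. sbst ?A \<mu> w x = x" "\<kappa> \<noteq> \<mu>" for \<kappa> \<mu> x y z
  proof (rule funs_eqI[of _ r U])
    fix s assume s: "s \<in> seqs r U"
    \<comment> \<open>Here \<open>w\<close> is \<open>sbst ?A \<kappa> x y\<close>, whose value at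
      \<open>s\<close> is exactly the entry written at \<mu>.\<close>
    have "x (s(\<mu> := y (s(\<kappa> := x s)))) = x s"
      using ind[OF that(6) sbst_full_in[OF that(1,3,4)] s] s by (simp add: app)
    then show "sbst ?A \<kappa> x (sbst ?A \<mu> y z) s = sbst ?A \<mu> (sbst ?A \<kappa> x y) (sbst ?A \<kappa> x z) s"
      using that s by (simp add: app fun_upd_twist)
  qed (use that in \<open>simp_all add: sbst_full_in\<close>)
  have 5: "sbst ?A \<kappa> (sbst ?A \<kappa> x y) z = sbst ?A \<kappa> x (sbst ?A \<kappa> y z)"
    if "\<kappa> \<in> Field r" "x \<in> funs r U" "y \<in> funs r U" "z \<in> funs r U" for \<kappa> x y z
    by (rule funs_eqI[of _ r U]) (use that in \<open>simp_all add: sbst_full_in app\<close>)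
  have 1: "sbst ?A \<kappa> x (vr ?A \<kappa>) = x" if "\<kappa> \<in> Field r" "x \<in> funs r U" for \<kappa> x
    by (rule funs_eqI[of _ r U]) (use that in \<open>simp_all add: sbst_full_in vr_full_in app\<close>)
  have 2: "sbst ?A \<kappa> x (vr ?A \<mu>) = vr ?A \<mu>"
    if "\<kappa> \<in> Field r" "\<mu> \<in> Field r" "x \<in> funs r U" "\<kappa> \<noteq> \<mu>" for \<kappa> \<mu> x
    by (rule funs_eqI[of _ r U]) (use that in \<open>simp_all add: sbst_full_in vr_full_in app\<close>)
  have 3: "sbst ?A \<kappa> (vr ?A \<kappa>) x = x" if "\<kappa> \<in> Field r" "x \<in> funs r U" for \<kappa> x
    by (rule funs_eqI[of _ r U]) (use that in \<open>simp_all add: sbst_full_in vr_full_in app\<close>)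
  show ?thesis
    unfolding SA_def elems_full
    by (intro conjI ballI impI) (blast intro: vr_full_in sbst_full_in 1 2 3 4 5 6)+
qed

lemma const_zerodim:
  assumes "c \<in> U"
  shows "(\<lambda>t\<in>seqs r U. c) \<in> zerodim r (full_struct r U)"
proof -
  have const: "(\<lambda>t\<in>seqs r U. c) \<in> funs r U" using assms by (auto simp: funs_def)
  have "sbst (full_struct r U) \<kappa> f (\<lambda>t\<in>seqs r U. c) = (\<lambda>t\<in>seqs r U. c)"
    if "\<kappa> \<in> Field r" "f \<in> funs r U" for \<kappa> f
    by (rule funs_eqI[OF sbst_full_in[OF that const] const])
      (use that in \<open>simp add: sbst_full_app seqs_upd funs_app\<close>)
  then show ?thesis using const by (auto simp: zerodim_def dimset_def)
qed

text \<open>Substituting the constant \<open>p \<kappa>\<close> at \<kappa> and then evaluating at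
  \<open>p\<close> means evaluating at \<open>p(\<kappa> := p \<kappa>)\<close>, which is
  \<open>p\<close> again. So no step of the fold changes the value at \<open>p\<close>.\<close>

lemma fold_sbst_const_app:
  assumes "p \<in> seqs r U" "set \<kappa>s \<subseteq> Field r" "a \<in> funs r U"
  shows "fold (\<lambda>\<kappa> x. sbst (full_struct r U) \<kappa> (\<lambda>t\<in>seqs r U. p \<kappa>) x) \<kappa>s a p = a p"
  using assms(2,3)
proof (induction \<kappa>s arbitrary: a)
  case (Cons \<kappa> \<kappa>s)
  have \<kappa>: "\<kappa> \<in> Field r" "p \<kappa> \<in> U" using Cons.prems(1) assms(1) by (auto simp: seqs_def)
  let ?c = "\<lambda>t\<in>seqs r U. p \<kappa>"
  have "?c \<in> funs r U" using \<kappa>(2) by (auto simp: funs_def)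
  then have "sbst (full_struct r U) \<kappa> ?c a \<in> funs r U"
    by (rule sbst_full_in[OF \<kappa>(1) _ Cons.prems(2)])
  moreover have "sbst (full_struct r U) \<kappa> ?c a p = a p"
    using assms(1) by (simp add: sbst_full_app)
  moreover have "set \<kappa>s \<subseteq> Field r" using Cons.prems(1) by simp
  ultimately show ?case using Cons.IH by (simp only: fold_simps)
qed simp

lemma strongly_distinguished_full:
  assumes r: "Well_order r"
  shows "strongly_distinguished r (full_struct r U)"
  unfolding strongly_distinguished_def elems_full
proof (intro ballI impI)
  fix a b
  assume a: "a \<in> funs r U" and b: "b \<in> funs r U"
    and H: "\<forall>s\<in>seqs r (zerodim r (full_struct r U)). \<exists>\<Sigma>. finite \<Sigma> \<and> \<Sigma> \<subseteq> Field r \<and>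
      multi_sbst r (full_struct r U) s \<Sigma> a = multi_sbst r (full_struct r U) s \<Sigma> b"
  show "a = b"
  proof (rule funs_eqI[OF a b])
    fix p assume p: "p \<in> seqs r U"
    define c where "c = (\<lambda>\<kappa>\<in>Field r. \<lambda>t\<in>seqs r U. p \<kappa>)"
    have "(\<lambda>t\<in>seqs r U. p \<kappa>) \<in> zerodim r (full_struct r U)" if "\<kappa> \<in> Field r" for \<kappa>
      using const_zerodim[of "p \<kappa>" U r] p that by (auto simp: seqs_def PiE_mem)
    then have "c \<in> seqs r (zerodim r (full_struct r U))"
      by (auto simp: c_def seqs_def)
    then obtain \<Sigma> where \<Sigma>: "finite \<Sigma>" "\<Sigma> \<subseteq> Field r" and
      eq: "multi_sbst r (full_struct r U) c \<Sigma> a = multi_sbst r (full_struct r U) c \<Sigma> b"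
      using H by blast
    have en: "set (enum r \<Sigma>) \<subseteq> Field r" using set_enum(2)[OF r \<Sigma>] \<Sigma>(2) by simp
    have "multi_sbst r (full_struct r U) c \<Sigma> f p = f p" if "f \<in> funs r U" for f
    proof -
      have "multi_sbst r (full_struct r U) c \<Sigma> f =
          fold (\<lambda>\<kappa> x. sbst (full_struct r U) \<kappa> (\<lambda>t\<in>seqs r U. p \<kappa>) x) (enum r \<Sigma>) f"
        unfolding multi_sbst_def by (rule fold_cong) (use en in \<open>auto simp: c_def\<close>)
      then show ?thesis using fold_sbst_const_app[OF p en that] by simp
    qed
    then show "a p = b p" using eq a b by metis
  qed
qed

section \<open>Representability as embeddability into a full function algebra\<close>

lemma embeddable_trans:
  assumes "embeddable r A B" "embeddable r B C"
  shows "embeddable r A C"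
proof -
  obtain h k where h: "is_hom r A B h" "inj_on h (elems A)"
    and k: "is_hom r B C k" "inj_on k (elems B)"
    using assms unfolding embeddable_def by blast
  have "h ` elems A \<subseteq> elems B" using h(1) by (auto simp: is_hom_def)
  then have "inj_on (k \<circ> h) (elems A)" using h(2) k(2) by (meson comp_inj_on inj_on_subset)
  moreover have "is_hom r A C (k \<circ> h)"
    using h(1) k(1) by (auto simp: is_hom_def Pi_iff)
  ultimately show ?thesis unfolding embeddable_def by blast
qed

text \<open>The operations of \<open>fun_struct r U F\<close> do not depend on \<open>F\<close>, so
  an isomorphism onto an algebra of functions is also an embedding into the algebra of all
  functions.\<close>

lemma representable_imp_embeddable_full:
  assumes "representable r (A :: ('a, 'i) subst_struct)"
  shows "\<exists>U :: ('a, 'i) univ set. embeddable r A (full_struct r U)"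
proof -
  obtain U :: "('a, 'i) univ set" and F h where F: "F \<subseteq> funs r U"
    and h: "is_hom r A (fun_struct r U F) h" "bij_betw h (elems A) (elems (fun_struct r U F))"
    using assms unfolding representable_def FSA_def isomorphic_def by blast
  have "is_hom r A (full_struct r U) h" "inj_on h (elems A)"
    using h F by (auto simp: is_hom_def fun_struct_def bij_betw_def)
  then show ?thesis unfolding embeddable_def by blast
qed

text \<open>The image of the embedding is closed under the operations. The type of \<open>U\<close>
  is arbitrary here, so that a reduced product can serve as base set; \<open>representableI\<close>
  then moves it into \<open>univ\<close>.\<close>

lemma embeddable_full_imp_representable:
  assumes A: "SA r A" and U: "U \<noteq> {}" and emb: "embeddable r A (full_struct r U)"
  shows "representable r A"
proof -
  obtain h where h: "is_hom r A (full_struct r U) h" "inj_on h (elems A)"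
    using emb unfolding embeddable_def by blast
  define B where "B = fun_struct r U (h ` elems A)"
  have v: "vr B \<kappa> = h (vr A \<kappa>)" "vr A \<kappa> \<in> elems A" if "\<kappa> \<in> Field r" for \<kappa>
    using that h(1) A by (auto simp: is_hom_def B_def fun_struct_def SA_def)
  have s: "sbst B \<kappa> (h x) (h y) = h (sbst A \<kappa> x y)" "sbst A \<kappa> x y \<in> elems A"
    if "\<kappa> \<in> Field r" "x \<in> elems A" "y \<in> elems A" for \<kappa> x y
    using that h(1) A by (auto simp: is_hom_def B_def fun_struct_def SA_def)
  have EB: "elems B = h ` elems A" by (simp add: B_def fun_struct_def)
  have "h ` elems A \<subseteq> funs r U" using h(1) by (auto simp: is_hom_def)
  then have "FSA r U B"
    unfolding FSA_def using U v s
    by (intro conjI exI[of _ "h ` elems A"]) (auto simp: B_def[symmetric])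
  moreover have "isomorphic r A B"
    unfolding isomorphic_def is_hom_def using h(2) v s EB
    by (intro exI[of _ h]) (auto simp: bij_betw_def)
  ultimately show ?thesis using representableI[OF A] by blast
qed

section \<open>The sets \<open>D\<^sub>\<Sigma>\<close> of independent elements\<close>

definition indep_elems :: "('a, 'i) subst_struct \<Rightarrow> 'i set \<Rightarrow> 'a set" where
  "indep_elems B \<Sigma> = {x \<in> elems B. \<forall>\<mu>\<in>\<Sigma>. \<forall>w\<in>elems B. sbst B \<mu> w x = x}"

locale sd_algebra =
  fixes r :: "'i rel" and B :: "('b, 'i) subst_struct"
  assumes wo: "Well_order r" and SA: "SA r B" and sd: "strongly_distinguished r B"
begin

abbreviation sub (\<open>sub\<^bsub>_\<^esub>\<close>) where "sub\<^bsub>\<kappa>\<^esub> \<equiv> sbst B \<kappa>"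

lemma vr_in: "\<kappa> \<in> Field r \<Longrightarrow> vr B \<kappa> \<in> elems B"
  and sub_in: "\<kappa> \<in> Field r \<Longrightarrow> x \<in> elems B \<Longrightarrow> y \<in> elems B \<Longrightarrow> sub\<^bsub>\<kappa>\<^esub> x y \<in> elems B"
  and sub_vr: "\<kappa> \<in> Field r \<Longrightarrow> x \<in> elems B \<Longrightarrow> sub\<^bsub>\<kappa>\<^esub> x (vr B \<kappa>) = x"
  and sub_vr_other:
    "\<kappa> \<in> Field r \<Longrightarrow> \<mu> \<in> Field r \<Longrightarrow> x \<in> elems B \<Longrightarrow> \<kappa> \<noteq> \<mu> \<Longrightarrow> sub\<^bsub>\<kappa>\<^esub> x (vr B \<mu>) = vr B \<mu>"
  and sub_assoc:
    "\<kappa> \<in> Field r \<Longrightarrow> x \<in> elems B \<Longrightarrow> y \<in> elems B \<Longrightarrow> z \<in> elems B \<Longrightarrow>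
      sub\<^bsub>\<kappa>\<^esub> (sub\<^bsub>\<kappa>\<^esub> x y) z = sub\<^bsub>\<kappa>\<^esub> x (sub\<^bsub>\<kappa>\<^esub> y z)"
  using SA by (auto simp: SA_def)

lemma sub_distrib:
  assumes "\<kappa> \<in> Field r" "\<mu> \<in> Field r" "\<kappa> \<noteq> \<mu>" "x \<in> indep_elems B {\<mu>}" "y \<in> elems B" "z \<in> elems B"
  shows "sub\<^bsub>\<kappa>\<^esub> x (sub\<^bsub>\<mu>\<^esub> y z) = sub\<^bsub>\<mu>\<^esub> (sub\<^bsub>\<kappa>\<^esub> x y) (sub\<^bsub>\<kappa>\<^esub> x z)"
  using SA assms by (simp add: SA_def indep_elems_def)

lemma indep_elemsD: "x \<in> indep_elems B \<Sigma> \<Longrightarrow> x \<in> elems B"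
  by (simp add: indep_elems_def)

lemma indep_elems_sub: "x \<in> indep_elems B \<Sigma> \<Longrightarrow> \<mu> \<in> \<Sigma> \<Longrightarrow> w \<in> elems B \<Longrightarrow> sub\<^bsub>\<mu>\<^esub> w x = x"
  by (simp add: indep_elems_def)

lemma indep_elems_antimono: "\<Sigma> \<subseteq> \<Sigma>' \<Longrightarrow> indep_elems B \<Sigma>' \<subseteq> indep_elems B \<Sigma>"
  by (auto simp: indep_elems_def)

lemma zerodim_indep: "x \<in> zerodim r B \<Longrightarrow> \<Sigma> \<subseteq> Field r \<Longrightarrow> x \<in> indep_elems B \<Sigma>"
  by (auto simp: zerodim_def dimset_def indep_elems_def)

text \<open>If there were no zero-dimensional elements and at least one index, there would be no
  sequence to test, so strong distinction would identify all elements. But then every element is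
  zero-dimensional.\<close>

lemma zerodim_nonempty:
  assumes "elems B \<noteq> {}"
  shows "zerodim r B \<noteq> {}"
proof
  assume Z: "zerodim r B = {}"
  obtain x where x: "x \<in> elems B" using assms by blast
  have "dimset r B x = {}"
  proof (rule ccontr)
    assume "dimset r B x \<noteq> {}"
    then obtain \<kappa> a where \<kappa>: "\<kappa> \<in> Field r" "a \<in> elems B" "sub\<^bsub>\<kappa>\<^esub> a x \<noteq> x"
      by (auto simp: dimset_def)
    have "seqs r (zerodim r B) = {}"
      using \<kappa>(1) by (auto simp: Z seqs_def)
    then show False
      using sd sub_in[OF \<kappa>(1,2) x] x \<kappa>(3) unfolding strongly_distinguished_def by blast
  qed
  then show False using x Z by (auto simp: zerodim_def)
qed

text \<open>Strong distinction allows any finite \<Sigma> for each sequence; the singleton of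
  \<kappa> serves for all of them.\<close>

lemma eq_if_sub_zerodim_eq:
  assumes "\<kappa> \<in> Field r" "a \<in> elems B" "b \<in> elems B"
    and "\<And>c. c \<in> zerodim r B \<Longrightarrow> sub\<^bsub>\<kappa>\<^esub> c a = sub\<^bsub>\<kappa>\<^esub> c b"
  shows "a = b"
proof -
  have "increasing r [\<kappa>] \<and> set [\<kappa>] = {\<kappa>}" by (simp add: increasing_def)
  then have "enum r {\<kappa>} = [\<kappa>]"
    unfolding enum_def using enum_ex1[OF wo, of "{\<kappa>}"] assms(1)
    by (intro the1_equality) auto
  then have "multi_sbst r B s {\<kappa>} a = multi_sbst r B s {\<kappa>} b"
    if "s \<in> seqs r (zerodim r B)" for s
    using that assms(1,4) by (auto simp: multi_sbst_def seqs_def PiE_mem)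
  then show ?thesis
    using sd assms(1-3) unfolding strongly_distinguished_def
    by (metis empty_subsetI finite.emptyI finite.insertI insert_subset)
qed

text \<open>The axioms yield the independence of \<open>sub\<^bsub>\<kappa>\<^esub> x y\<close> from \<open>\<mu>\<close> only when tested against w
  independent of \<open>\<kappa>\<close>; the substitution of a zero-dimensional c at \<open>\<kappa>\<close> reduces the general
  case to this one.\<close>

lemma indep_sub_other:
  assumes k: "\<kappa> \<in> Field r" "\<mu> \<in> Field r" "\<kappa> \<noteq> \<mu>"
    and x: "x \<in> indep_elems B {\<mu>}" and y: "y \<in> indep_elems B {\<mu>}"
  shows "sub\<^bsub>\<kappa>\<^esub> x y \<in> indep_elems B {\<mu>}"
proof -
  note in_B = indep_elemsD[OF x] indep_elemsD[OF y]
  have "sub\<^bsub>\<mu>\<^esub> w (sub\<^bsub>\<kappa>\<^esub> x y) = sub\<^bsub>\<kappa>\<^esub> x y" if w: "w \<in> elems B" for w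
  proof (rule eq_if_sub_zerodim_eq[OF k(1)])
    fix c assume c: "c \<in> zerodim r B"
    have ck: "c \<in> indep_elems B {\<kappa>}" and cm: "c \<in> indep_elems B {\<mu>}"
      using zerodim_indep[OF c] k by auto
    have cB: "c \<in> elems B" by (rule indep_elemsD[OF ck])
    define w' where "w' = sub\<^bsub>\<kappa>\<^esub> c w"
    have wB: "w' \<in> elems B" unfolding w'_def by (rule sub_in[OF k(1) cB w])
    have "sub\<^bsub>\<kappa>\<^esub> u w' = w'" if "u \<in> elems B" for u
      using sub_assoc[OF k(1) that cB w] indep_elems_sub[OF ck _ that] by (simp add: w'_def)
    then have w': "w' \<in> indep_elems B {\<kappa>}" using wB by (simp add: indep_elems_def)
    \<comment> \<open>As \<open>w'\<close> is independent of \<kappa>, axiom 6 lets its substitution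
      at \<mu> pass through a substitution at \<kappa>. There it meets only \<open>c\<close> and
      \<open>x\<close>, both independent of \<mu>.\<close>
    have cx: "sub\<^bsub>\<mu>\<^esub> w' (sub\<^bsub>\<kappa>\<^esub> c x) = sub\<^bsub>\<kappa>\<^esub> c x"
      using sub_distrib[OF k(2,1) k(3)[symmetric] w' cB in_B(1)]
        indep_elems_sub[OF cm _ wB] indep_elems_sub[OF x _ wB] by simp
    have "sub\<^bsub>\<kappa>\<^esub> c (sub\<^bsub>\<mu>\<^esub> w (sub\<^bsub>\<kappa>\<^esub> x y)) = sub\<^bsub>\<mu>\<^esub> w' (sub\<^bsub>\<kappa>\<^esub> c (sub\<^bsub>\<kappa>\<^esub> x y))"
      unfolding w'_def by (rule sub_distrib[OF k cm w sub_in[OF k(1) in_B]])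
    also have "\<dots> = sub\<^bsub>\<mu>\<^esub> w' (sub\<^bsub>\<kappa>\<^esub> (sub\<^bsub>\<kappa>\<^esub> c x) y)"
      by (simp add: sub_assoc[OF k(1) cB in_B])
    also have "\<dots> = sub\<^bsub>\<kappa>\<^esub> (sub\<^bsub>\<kappa>\<^esub> c x) y"
      using sub_distrib[OF k(2,1) k(3)[symmetric] w' sub_in[OF k(1) cB in_B(1)] in_B(2)]
        cx indep_elems_sub[OF y _ wB] by simp
    also have "\<dots> = sub\<^bsub>\<kappa>\<^esub> c (sub\<^bsub>\<kappa>\<^esub> x y)"
      by (rule sub_assoc[OF k(1) cB in_B])
    finally show "sub\<^bsub>\<kappa>\<^esub> c (sub\<^bsub>\<mu>\<^esub> w (sub\<^bsub>\<kappa>\<^esub> x y)) = sub\<^bsub>\<kappa>\<^esub> c (sub\<^bsub>\<kappa>\<^esub> x y)" .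
  qed (use k w in_B in \<open>simp_all add: sub_in\<close>)
  then show ?thesis using k in_B by (simp add: indep_elems_def sub_in)
qed

text \<open>By associativity, a further substitution at \<kappa> falls on \<open>x\<close>, which
  absorbs it.\<close>

lemma indep_sub_same:
  assumes k: "\<kappa> \<in> Field r" and x: "x \<in> indep_elems B {\<kappa>}" and y: "y \<in> elems B"
  shows "sub\<^bsub>\<kappa>\<^esub> x y \<in> indep_elems B {\<kappa>}"
  using assms sub_assoc[OF k _ indep_elemsD[OF x] y] by (auto simp: indep_elems_def sub_in)

section \<open>Iterated substitution along a list of indices\<close>

definition msub :: "('i \<Rightarrow> 'b) \<Rightarrow> 'i list \<Rightarrow> 'b \<Rightarrow> 'b" where
  "msub q \<kappa>s = fold (\<lambda>\<kappa>. sub\<^bsub>\<kappa>\<^esub> (q \<kappa>)) \<kappa>s"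

lemma msub_Nil [simp]: "msub q [] x = x"
  and msub_Cons [simp]: "msub q (\<kappa> # \<kappa>s) x = msub q \<kappa>s (sub\<^bsub>\<kappa>\<^esub> (q \<kappa>) x)"
  and msub_append [simp]: "msub q (\<kappa>s @ \<mu>s) x = msub q \<mu>s (msub q \<kappa>s x)"
  by (simp_all add: msub_def)

lemma msub_cong: "(\<And>\<kappa>. \<kappa> \<in> set \<kappa>s \<Longrightarrow> q \<kappa> = q' \<kappa>) \<Longrightarrow> msub q \<kappa>s x = msub q' \<kappa>s x"
  by (induction \<kappa>s arbitrary: x) auto

lemma msub_in:
  assumes "set \<kappa>s \<subseteq> Field r" "\<And>\<kappa>. \<kappa> \<in> set \<kappa>s \<Longrightarrow> q \<kappa> \<in> elems B" "x \<in> elems B"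
  shows "msub q \<kappa>s x \<in> elems B"
  using assms by (induction \<kappa>s arbitrary: x) (auto simp: sub_in)

lemma msub_indep:
  assumes "set \<kappa>s \<subseteq> \<Sigma>" "\<And>\<kappa>. \<kappa> \<in> set \<kappa>s \<Longrightarrow> q \<kappa> \<in> elems B" "x \<in> indep_elems B \<Sigma>"
  shows "msub q \<kappa>s x = x"
  using assms by (induction \<kappa>s) (auto simp: indep_elems_sub)

lemma msub_other_indep:
  assumes "\<mu> \<in> Field r" "set \<kappa>s \<subseteq> Field r" "\<mu> \<notin> set \<kappa>s"
    "\<And>\<kappa>. \<kappa> \<in> set \<kappa>s \<Longrightarrow> q \<kappa> \<in> indep_elems B {\<mu>}" "x \<in> indep_elems B {\<mu>}"
  shows "msub q \<kappa>s x \<in> indep_elems B {\<mu>}"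
  using assms by (induction \<kappa>s arbitrary: x) (auto simp: indep_sub_other)

lemma msub_distrib:
  assumes "\<mu> \<in> Field r" "set \<kappa>s \<subseteq> Field r" "\<mu> \<notin> set \<kappa>s"
    "\<And>\<kappa>. \<kappa> \<in> set \<kappa>s \<Longrightarrow> q \<kappa> \<in> indep_elems B {\<mu>}" "f \<in> elems B" "g \<in> elems B"
  shows "msub q \<kappa>s (sub\<^bsub>\<mu>\<^esub> f g) = sub\<^bsub>\<mu>\<^esub> (msub q \<kappa>s f) (msub q \<kappa>s g)"
  using assms
proof (induction \<kappa>s arbitrary: f g)
  case (Cons \<kappa> \<kappa>s)
  have "q \<kappa> \<in> elems B" using Cons.prems by (auto intro: indep_elemsD)
  then show ?case
    using Cons sub_distrib[of \<kappa> \<mu> "q \<kappa>" f g] by (auto simp: sub_in)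
qed simp

section \<open>Simultaneous substitution along an enumerated finite index set\<close>

context
  fixes \<Sigma> :: "'i set" and \<kappa>s :: "'i list" and q :: "'i \<Rightarrow> 'b"
  assumes \<kappa>s: "set \<kappa>s = \<Sigma>" "distinct \<kappa>s" and \<Sigma>: "\<Sigma> \<subseteq> Field r"
    and q: "\<And>\<kappa>. \<kappa> \<in> \<Sigma> \<Longrightarrow> q \<kappa> \<in> indep_elems B \<Sigma>"
begin

lemma q_single: "\<kappa> \<in> \<Sigma> \<Longrightarrow> \<mu> \<in> \<Sigma> \<Longrightarrow> q \<kappa> \<in> indep_elems B {\<mu>}"
  using q[of \<kappa>] indep_elems_antimono[of "{\<mu>}" \<Sigma>] by auto

lemma q_in: "\<kappa> \<in> \<Sigma> \<Longrightarrow> q \<kappa> \<in> elems B"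
  using q indep_elemsD by blast

text \<open>Split the list at \<mu>. The substitution at \<mu> produces independence of \<mu>, and
  the later ones, at other indices and by elements independent of \<mu>, preserve it.\<close>

lemma msub_in_indep:
  assumes x: "x \<in> elems B"
  shows "msub q \<kappa>s x \<in> indep_elems B \<Sigma>"
proof -
  have "msub q \<kappa>s x \<in> indep_elems B {\<mu>}" if \<mu>: "\<mu> \<in> \<Sigma>" for \<mu>
  proof -
    obtain xs ys where xy: "\<kappa>s = xs @ \<mu> # ys" using \<mu> \<kappa>s(1) by (meson split_list)
    have sets: "set xs \<subseteq> \<Sigma>" "set ys \<subseteq> \<Sigma>" "\<mu> \<notin> set ys" using \<kappa>s xy by auto
    have "msub q xs x \<in> elems B"
      using sets \<Sigma> by (intro msub_in q_in x) auto
    then have "sub\<^bsub>\<mu>\<^esub> (q \<mu>) (msub q xs x) \<in> indep_elems B {\<mu>}"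
      using \<mu> \<Sigma> q_single by (intro indep_sub_same) auto
    then have "msub q ys (sub\<^bsub>\<mu>\<^esub> (q \<mu>) (msub q xs x)) \<in> indep_elems B {\<mu>}"
      using sets \<mu> \<Sigma> by (intro msub_other_indep q_single) auto
    then show ?thesis by (simp add: xy)
  qed
  moreover have "msub q \<kappa>s x \<in> elems B" using \<kappa>s \<Sigma> x by (intro msub_in q_in) auto
  ultimately show ?thesis by (auto simp: indep_elems_def)
qed

text \<open>The substitutions before \<mu> fix the variable, the one at \<mu> turns it into
  \<open>q \<mu>\<close>, and the later ones fix \<open>q \<mu>\<close> because it is independent of
  all of \<Sigma>.\<close>

lemma msub_vr:
  assumes \<mu>: "\<mu> \<in> \<Sigma>"
  shows "msub q \<kappa>s (vr B \<mu>) = q \<mu>"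
proof -
  obtain xs ys where xy: "\<kappa>s = xs @ \<mu> # ys" using \<mu> \<kappa>s(1) by (meson split_list)
  have sets: "set xs \<subseteq> \<Sigma>" "set ys \<subseteq> \<Sigma>" "\<mu> \<notin> set xs" using \<kappa>s xy by auto
  have "msub q xs (vr B \<mu>) = vr B \<mu>"
    using sets(1,3) by (induction xs) (use \<mu> \<Sigma> q_in in \<open>auto simp: sub_vr_other subset_iff\<close>)
  moreover have "msub q ys (q \<mu>) = q \<mu>"
    using sets by (intro msub_indep[of _ \<Sigma>] q_in q \<mu>) auto
  ultimately show ?thesis using \<mu> \<Sigma> q_in by (auto simp: xy sub_vr)
qed

lemma msub_sub:
  assumes \<mu>: "\<mu> \<in> \<Sigma>" and f: "f \<in> elems B" and g: "g \<in> elems B"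
  shows "msub q \<kappa>s (sub\<^bsub>\<mu>\<^esub> f g) = msub (q(\<mu> := msub q \<kappa>s f)) \<kappa>s g"
proof -
  obtain xs ys where xy: "\<kappa>s = xs @ \<mu> # ys" using \<mu> \<kappa>s(1) by (meson split_list)
  have xs: "set xs \<subseteq> Field r" "\<mu> \<notin> set xs" "\<And>\<kappa>. \<kappa> \<in> set xs \<Longrightarrow> q \<kappa> \<in> indep_elems B {\<mu>}"
    and ys: "set ys \<subseteq> Field r" "\<mu> \<notin> set ys" "\<And>\<kappa>. \<kappa> \<in> set ys \<Longrightarrow> q \<kappa> \<in> indep_elems B {\<mu>}"
    using \<kappa>s xy \<Sigma> q_single[OF _ \<mu>] by auto
  have xsB: "msub q xs x \<in> elems B" if "x \<in> elems B" for x
    using xs that by (intro msub_in) (auto intro: indep_elemsD)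
  have m: "\<mu> \<in> Field r" "q \<mu> \<in> elems B" using \<mu> \<Sigma> q_in by auto
  define F where "F = msub q \<kappa>s f"
  have F: "F \<in> indep_elems B \<Sigma>" unfolding F_def by (rule msub_in_indep[OF f])
  have "msub q \<kappa>s (sub\<^bsub>\<mu>\<^esub> f g) =
      msub q ys (sub\<^bsub>\<mu>\<^esub> (sub\<^bsub>\<mu>\<^esub> (q \<mu>) (msub q xs f)) (msub q xs g))"
    using msub_distrib[OF m(1) xs f g] sub_assoc[OF m xsB[OF f] xsB[OF g]] by (simp add: xy)
  also have "\<dots> = sub\<^bsub>\<mu>\<^esub> F (msub q ys (msub q xs g))"
    using msub_distrib[OF m(1) ys sub_in[OF m xsB[OF f]] xsB[OF g]] by (simp add: F_def xy)
  \<comment> \<open>The substitution at \<mu> is now outermost, but in \<open>\<kappa>s\<close> it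
    precedes \<open>ys\<close>. Since \<open>F\<close> is independent of \<Sigma>, the substitutions
    along \<open>ys\<close> may be applied to it too, and distributivity read backwards pulls them
    out.\<close>
  also have "\<dots> = sub\<^bsub>\<mu>\<^esub> (msub q ys F) (msub q ys (msub q xs g))"
    using \<kappa>s xy by (subst msub_indep[OF _ _ F]) (auto intro: q_in)
  also have "\<dots> = msub q ys (sub\<^bsub>\<mu>\<^esub> F (msub q xs g))"
    by (rule msub_distrib[OF m(1) ys indep_elemsD[OF F] xsB[OF g], symmetric])
  also have "\<dots> = msub (q(\<mu> := F)) \<kappa>s g"
  proof -
    have "msub (q(\<mu> := F)) xs x = msub q xs x" "msub (q(\<mu> := F)) ys x = msub q ys x" for x
      using xs(2) ys(2) by (auto intro!: msub_cong)
    then show ?thesis by (simp add: xy)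
  qed
  finally show ?thesis by (simp add: F_def)
qed

end

section \<open>The reduced product and its canonical representatives\<close>

definition families :: "('i set \<Rightarrow> 'b) set" where
  "families = {u. \<forall>\<Sigma>. finite \<Sigma> \<longrightarrow> \<Sigma> \<subseteq> Field r \<longrightarrow> u \<Sigma> \<in> indep_elems B \<Sigma>}"

abbreviation fin :: "'i set filter" where
  "fin \<equiv> finite_subsets_at_top (Field r)"

text \<open>A representative of the class of u in the reduced product. Preferring constant families
  is essential for faithfulness: an arbitrary representative of the constant family of \<open>s\<^sub>\<kappa>\<close>
  takes the value \<open>s\<^sub>\<kappa>\<close> only from some \<open>\<Sigma>\<close> on, and for infinitely many \<open>\<kappa>\<close> there need not be
  a common such \<open>\<Sigma>\<close>.\<close>

definition canon :: "('i set \<Rightarrow> 'b) \<Rightarrow> ('i set \<Rightarrow> 'b)" where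
  "canon u = (SOME v. v \<in> families \<and> (\<forall>\<^sub>F \<Sigma> in fin. v \<Sigma> = u \<Sigma>) \<and>
     ((\<exists>c. (\<lambda>_. c) \<in> families \<and> (\<forall>\<^sub>F \<Sigma> in fin. c = u \<Sigma>)) \<longrightarrow> (\<exists>c. v = (\<lambda>_. c))))"

lemma canon_spec:
  assumes "u \<in> families"
  shows "canon u \<in> families \<and> (\<forall>\<^sub>F \<Sigma> in fin. canon u \<Sigma> = u \<Sigma>) \<and>
     ((\<exists>c. (\<lambda>_. c) \<in> families \<and> (\<forall>\<^sub>F \<Sigma> in fin. c = u \<Sigma>)) \<longrightarrow> (\<exists>c. canon u = (\<lambda>_. c)))"
proof -
  let ?const = "\<exists>c. (\<lambda>_. c) \<in> families \<and> (\<forall>\<^sub>F \<Sigma> in fin. c = u \<Sigma>)"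
  have "\<exists>v. v \<in> families \<and> (\<forall>\<^sub>F \<Sigma> in fin. v \<Sigma> = u \<Sigma>) \<and> (?const \<longrightarrow> (\<exists>c. v = (\<lambda>_. c)))"
  proof (cases ?const)
    case False
    show ?thesis by (intro exI[of _ u] conjI impI) (use assms False in simp_all)
  qed blast
  then show ?thesis unfolding canon_def by (rule someI_ex)
qed

lemma canon:
  assumes "u \<in> families"
  shows "canon u \<in> families" "\<forall>\<^sub>F \<Sigma> in fin. canon u \<Sigma> = u \<Sigma>"
  using canon_spec[OF assms] by blast+

lemma canon_const:
  assumes "(\<lambda>_. c) \<in> families"
  shows "canon (\<lambda>_. c) = (\<lambda>_. c)"
proof -
  obtain d where d: "canon (\<lambda>_. c) = (\<lambda>_. d)"
    using canon_spec[OF assms] assms by auto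
  \<comment> \<open>The filter \<open>fin\<close> is proper, so two constants that agree eventually
    are equal.\<close>
  then show ?thesis
    using canon(2)[OF assms] by (simp add: eventually_const)
qed

text \<open>The description from which \<open>canon u\<close> is chosen mentions \<open>u\<close>
  only through eventual equalities. Equivalent families thus share one description, and the choice
  falls on the same representative.\<close>

lemma canon_cong:
  assumes "\<forall>\<^sub>F \<Sigma> in fin. u \<Sigma> = v \<Sigma>"
  shows "canon u = canon v"
proof -
  have "(\<forall>\<^sub>F \<Sigma> in fin. w \<Sigma> = u \<Sigma>) \<longleftrightarrow> (\<forall>\<^sub>F \<Sigma> in fin. w \<Sigma> = v \<Sigma>)" for w
    by (rule eventually_cong[OF assms]) simp
  from this this[of "\<lambda>_. c" for c] show ?thesis by (simp add: canon_def)
qed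

text \<open>Canonical representatives stand in for the equivalence classes, so elements of the base
  can be evaluated at each \<Sigma>.\<close>

definition base :: "('i set \<Rightarrow> 'b) set" where
  "base = canon ` families"

lemma base_subset: "base \<subseteq> families"
  by (auto simp: base_def canon)

lemma canon_base:
  assumes "u \<in> base" shows "canon u = u"
proof -
  obtain v where v: "v \<in> families" "u = canon v" using assms by (auto simp: base_def)
  then show ?thesis using canon_cong[OF canon(2)[OF v(1)]] by simp
qed

section \<open>The representation by functions on the base set\<close>

definition act :: "'b \<Rightarrow> ('i \<Rightarrow> 'i set \<Rightarrow> 'b) \<Rightarrow> 'i set \<Rightarrow> 'b" where
  "act g p \<Sigma> = msub (\<lambda>\<kappa>. p \<kappa> \<Sigma>) (enum r \<Sigma>) g"

definition rep :: "'b \<Rightarrow> ('i \<Rightarrow> 'i set \<Rightarrow> 'b) \<Rightarrow> 'i set \<Rightarrow> 'b" where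
  "rep g = (\<lambda>p\<in>seqs r base. canon (act g p))"

lemma enum_props:
  assumes "finite \<Sigma>" "\<Sigma> \<subseteq> Field r"
  shows "set (enum r \<Sigma>) = \<Sigma>" "distinct (enum r \<Sigma>)"
proof -
  have "distinct xs" if "increasing r xs" for xs
    using that by (induction xs) (auto simp: increasing_def)
  then show "set (enum r \<Sigma>) = \<Sigma>" "distinct (enum r \<Sigma>)" using set_enum[OF wo assms] by auto
qed

lemma seq_indep:
  assumes "p \<in> seqs r families" "finite \<Sigma>" "\<Sigma> \<subseteq> Field r" "\<kappa> \<in> \<Sigma>"
  shows "p \<kappa> \<Sigma> \<in> indep_elems B \<Sigma>"
proof -
  have "p \<kappa> \<in> families" using assms by (auto simp: seqs_def PiE_mem)
  then show ?thesis using assms by (simp add: families_def)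
qed

lemma seqs_base_families: "p \<in> seqs r base \<Longrightarrow> p \<in> seqs r families"
  using base_subset by (auto simp: seqs_def PiE_def Pi_def)

lemma act_families: "g \<in> elems B \<Longrightarrow> p \<in> seqs r families \<Longrightarrow> act g p \<in> families"
  using msub_in_indep[OF enum_props] by (simp add: act_def families_def seq_indep)

lemma rep_funs: "g \<in> elems B \<Longrightarrow> rep g \<in> funs r base"
  by (auto simp: rep_def funs_def base_def act_families seqs_base_families[unfolded base_def])

lemma eventually_fin_mem:
  assumes "\<kappa> \<in> Field r"
    and "\<And>\<Sigma>. finite \<Sigma> \<Longrightarrow> \<Sigma> \<subseteq> Field r \<Longrightarrow> \<kappa> \<in> \<Sigma> \<Longrightarrow> P \<Sigma>"
  shows "\<forall>\<^sub>F \<Sigma> in fin. P \<Sigma>"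
  unfolding eventually_finite_subsets_at_top using assms
  by (intro exI[of _ "{\<kappa>}"]) auto

lemma rep_vr:
  assumes k: "\<kappa> \<in> Field r"
  shows "rep (vr B \<kappa>) = vr (full_struct r base) \<kappa>"
proof (rule funs_eqI[OF rep_funs[OF vr_in[OF k]] vr_full_in[OF k]])
  fix p assume p: "p \<in> seqs r base"
  have "\<forall>\<^sub>F \<Sigma> in fin. act (vr B \<kappa>) p \<Sigma> = p \<kappa> \<Sigma>"
    using msub_vr[OF enum_props] seq_indep[OF seqs_base_families[OF p]]
    by (intro eventually_fin_mem[OF k]) (simp add: act_def)
  then have "canon (act (vr B \<kappa>) p) = canon (p \<kappa>)" by (rule canon_cong)
  also have "\<dots> = p \<kappa>" using p k by (intro canon_base) (auto simp: seqs_def PiE_mem)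
  finally show "rep (vr B \<kappa>) p = vr (full_struct r base) \<kappa> p"
    using p by (simp add: rep_def vr_full_app)
qed

text \<open>The composition law \<open>msub_sub\<close> applies at every finite \<Sigma> containing
  \<kappa>, hence eventually, and \<open>canon\<close> turns eventual equality into
  equality.\<close>

lemma rep_sbst:
  assumes k: "\<kappa> \<in> Field r" and f: "f \<in> elems B" and g: "g \<in> elems B"
  shows "rep (sub\<^bsub>\<kappa>\<^esub> f g) = sbst (full_struct r base) \<kappa> (rep f) (rep g)"
proof (rule funs_eqI[OF rep_funs[OF sub_in[OF assms]] sbst_full_in[OF k rep_funs[OF f] rep_funs[OF g]]])
  fix p assume p: "p \<in> seqs r base"
  let ?p' = "p(\<kappa> := rep f p)"
  have p': "?p' \<in> seqs r base" by (rule seqs_upd[OF p k funs_app[OF rep_funs[OF f] p]])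
  \<comment> \<open>The new entry \<open>rep f p\<close> is a canonical representative, so it is
    known to agree with \<open>act f p\<close> only eventually.\<close>
  have 1: "\<forall>\<^sub>F \<Sigma> in fin. rep f p \<Sigma> = act f p \<Sigma>"
    using canon(2)[OF act_families[OF f seqs_base_families[OF p]]] p by (simp add: rep_def)
  have 2: "\<forall>\<^sub>F \<Sigma> in fin. act (sub\<^bsub>\<kappa>\<^esub> f g) p \<Sigma> =
      msub ((\<lambda>\<mu>. p \<mu> \<Sigma>)(\<kappa> := act f p \<Sigma>)) (enum r \<Sigma>) g"
    using msub_sub[OF enum_props _ _ _ f g] seq_indep[OF seqs_base_families[OF p]]
    by (intro eventually_fin_mem[OF k]) (simp add: act_def)
  have "\<forall>\<^sub>F \<Sigma> in fin. act (sub\<^bsub>\<kappa>\<^esub> f g) p \<Sigma> = act g ?p' \<Sigma>"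
    using 1 2
  proof eventually_elim
    case (elim \<Sigma>)
    have "(\<lambda>\<mu>. p \<mu> \<Sigma>)(\<kappa> := act f p \<Sigma>) = (\<lambda>\<mu>. ?p' \<mu> \<Sigma>)" using elim(1) by auto
    then show ?case using elim(2) by (simp add: act_def)
  qed
  then have "canon (act (sub\<^bsub>\<kappa>\<^esub> f g) p) = canon (act g ?p')" by (rule canon_cong)
  then show "rep (sub\<^bsub>\<kappa>\<^esub> f g) p = sbst (full_struct r base) \<kappa> (rep f) (rep g) p"
    using p p' by (simp add: sbst_full_app) (simp add: rep_def)
qed

text \<open>A sequence of zero-dimensional elements becomes a sequence of constant families. Equal
  values of \<open>rep a\<close> and \<open>rep b\<close> there make the two actions agree
  eventually, in particular at one finite \<Sigma>, as strong distinction demands.\<close>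

lemma rep_inj: "inj_on rep (elems B)"
proof (rule inj_onI)
  fix a b assume a: "a \<in> elems B" and b: "b \<in> elems B" and eq: "rep a = rep b"
  have "\<exists>\<Sigma>. finite \<Sigma> \<and> \<Sigma> \<subseteq> Field r \<and> multi_sbst r B s \<Sigma> a = multi_sbst r B s \<Sigma> b"
    if s: "s \<in> seqs r (zerodim r B)" for s
  proof -
    define p where "p = (\<lambda>\<kappa>\<in>Field r. \<lambda>_ :: 'i set. s \<kappa>)"
    have const: "(\<lambda>_. c) \<in> base" if "c \<in> zerodim r B" for c
    proof -
      have "(\<lambda>_. c) \<in> families" using zerodim_indep[OF that] by (simp add: families_def)
      then show ?thesis unfolding base_def using canon_const by (metis imageI)
    qed
    have p: "p \<in> seqs r base" using s const by (auto simp: p_def seqs_def PiE_mem)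
    note act = canon(2)[OF act_families[OF _ seqs_base_families[OF p]]]
    have "canon (act a p) = canon (act b p)"
      using fun_cong[OF eq, of p] p by (simp add: rep_def)
    then have "\<forall>\<^sub>F \<Sigma> in fin. act a p \<Sigma> = act b p \<Sigma>"
      using act[OF a] act[OF b] by (auto elim: eventually_elim2)
    then obtain \<Sigma> where \<Sigma>: "finite \<Sigma>" "\<Sigma> \<subseteq> Field r" "act a p \<Sigma> = act b p \<Sigma>"
      unfolding eventually_finite_subsets_at_top by blast
    \<comment> \<open>The entries of \<open>p\<close> are exactly constant, so no further
      enlargement of \<Sigma> is needed for them to take the values of \<open>s\<close>.\<close>
    have "act g p \<Sigma> = multi_sbst r B s \<Sigma> g" for g
      unfolding multi_sbst_def act_def msub_def[symmetric]
      using enum_props[OF \<Sigma>(1,2)] \<Sigma>(2) by (intro msub_cong) (auto simp: p_def)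
    then show ?thesis using \<Sigma> by auto
  qed
  then show "a = b" using sd a b unfolding strongly_distinguished_def by blast
qed

lemma embeddable_full_base: "embeddable r B (full_struct r base)"
  unfolding embeddable_def is_hom_def
  using rep_inj by (intro exI[of _ rep]) (simp add: rep_funs rep_vr rep_sbst)

lemma base_nonempty:
  assumes "elems B \<noteq> {}" shows "base \<noteq> {}"
proof -
  obtain c where "c \<in> zerodim r B" using zerodim_nonempty[OF assms] by blast
  then have "(\<lambda>_. c) \<in> families" by (simp add: families_def zerodim_indep)
  then show ?thesis by (auto simp: base_def)
qed

end

theorem theorem3p4:
  fixes r :: "'i rel" and A :: "('a, 'i) subst_struct"
  assumes "Well_order r" and "SA r A"
  shows "representable r A \<longleftrightarrow>
    (\<exists>B :: (('a, 'i) univ, 'i) subst_struct.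
       SA r B \<and> strongly_distinguished r B \<and> embeddable r A B)"
proof
  assume "representable r A"
  then obtain U :: "('a, 'i) univ set" where "embeddable r A (full_struct r U)"
    using representable_imp_embeddable_full by blast
  \<comment> \<open>The full function algebra is not carried by \<open>univ\<close>;
    \<open>sd_embeddableI\<close> replaces it by an algebra that is.\<close>
  then show "\<exists>B :: (('a, 'i) univ, 'i) subst_struct.
      SA r B \<and> strongly_distinguished r B \<and> embeddable r A B"
    by (rule sd_embeddableI[OF assms(1) SA_full strongly_distinguished_full[OF assms(1)]])
next
  assume "\<exists>B :: (('a, 'i) univ, 'i) subst_struct.
      SA r B \<and> strongly_distinguished r B \<and> embeddable r A B"
  then obtain B :: "(('a, 'i) univ, 'i) subst_struct"
    where B: "SA r B" "strongly_distinguished r B" and emb: "embeddable r A B" by blast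
  interpret sd_algebra r B using assms(1) B by unfold_locales
  show "representable r A"
  proof (cases "elems A = {}")
    \<comment> \<open>Without elements there are no variables, so the dimension is 0. Then
      \<open>B\<close>, and with it \<open>base\<close>, may be empty too, so a one-point base set
      is taken; any map embeds the empty algebra.\<close>
    case True
    then have "Field r = {}" using assms(2) by (auto simp: SA_def)
    then have "embeddable r A (full_struct r (UNIV :: unit set))"
      using True by (simp add: embeddable_def is_hom_def)
    then show ?thesis by (rule embeddable_full_imp_representable[OF assms(2) UNIV_not_empty])
  next
    case False
    then have "elems B \<noteq> {}" using emb by (auto simp: embeddable_def is_hom_def)
    then show ?thesis
      using embeddable_full_imp_representable[OF assms(2) base_nonempty]
        embeddable_trans[OF emb embeddable_full_base] by blast
  qed
qed

end
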